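(* For every field $\mathbf{k}$ and every graph $G$, $$s_{\mathbf{k}}\chi(G)=s'_{\mathbf{k}}\chi(G)=s''_{\mathbf{k}}\chi(G).$$
   Context: Graphs are simple and undirected; $N(x)$ denotes the set of neighbours of a vertex $x$ (not containing $x$); $\langle S\rangle$ is the linear span (of vectors, or of the union of a set of subspaces). $P\mathbf{k}^n$ is the set of $1$-dimensional subspaces of $\mathbf{k}^n$, and $\mathrm{Gr}_{n-1}(\mathbf{k}^n)$ the set of $(n-1)$-dimensional subspaces. For a graph $G$ with vertex set $V(G)$: - An $n$-weak span colouring of $G$ over $\mathbf{k}$ is a function $f\colon V(G)\to\mathbf{k}^n\setminus\{0\}$ such that $f(x)\notin\langle f(N(x))\rangle$ for every vertex $x$. The least $n$ for which one exists is $s''_{\mathbf{k}}\chi(G)$. - An $n$-intermediate span colouring of $G$ over $\mathbf{k}$ is a function $f\colon V(G)\to P\mathbf{k}^n$ such that $f(x)\not\subset\langle f(N(x))\rangle$ for every vertex $x$. The least $n$ for which one exists is $s'_{\mathbf{k}}\chi(G)$. - An $n$-span colouring of $G$ over $\mathbf{k}$ is a function $f\colon V(G)\to P\mathbf{k}^n\times\mathrm{Gr}_{n-1}(\mathbf{k}^n)$ such that for each vertex $x$ with $f(x)=(U,V)$ one has $U\not\subset V$, and for every edge $(x,y)$ with $f(y)=(U',V')$ one has $U\subset V'$ and $U'\subset V$. The least $n$ for which one exists is $s_{\mathbf{k}}\chi(G)$. Each of the three numbers is taken to be $\infty$ if no such $n$ exists. *)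

theory Defs
  imports
    "Jordan_Normal_Form.VS_Connect"
    "Graph_Theory.Pair_Digraph"
    "HOL-Library.Extended_Nat"
    "HOL-Library.FuncSet"
begin

text \<open>
  Simple undirected graphs are given by \<^locale>\<open>pair_bidirected_digraph\<close>: an undirected edge
  between \<open>x\<close> and \<open>y\<close> is represented by the two arcs \<open>(x, y)\<close> and \<open>(y, x)\<close>, there are no loops,
  and the vertex set may be infinite or empty.
\<close>

definition neighbours :: "'v pair_pre_digraph \<Rightarrow> 'v \<Rightarrow> 'v set" where
  "neighbours G x = {y. (x, y) \<in> parcs G}"

text \<open>
  The space \<open>k\<^sup>n\<close> is \<^term>\<open>module_vec TYPE('k::field) n\<close>, with carrier \<^term>\<open>carrier_vec n\<close>.
\<close>

abbreviation vspan :: "nat \<Rightarrow> 'k::field vec set \<Rightarrow> 'k vec set" where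
  "vspan n \<equiv> LinearCombinations.module.span class_ring (module_vec TYPE('k) n)"

abbreviation vsubspace :: "nat \<Rightarrow> 'k::field vec set \<Rightarrow> bool" where
  "vsubspace n W \<equiv> VectorSpace.subspace class_ring W (module_vec TYPE('k) n)"

abbreviation vdim :: "nat \<Rightarrow> 'k::field vec set \<Rightarrow> nat" where
  "vdim n W \<equiv> vectorspace.dim class_ring ((module_vec TYPE('k) n)\<lparr>carrier := W\<rparr>)"

definition proj_space :: "nat \<Rightarrow> 'k::field vec set set" where
  "proj_space n = {U. vsubspace n U \<and> vdim n U = 1}"

text \<open>
  Writing the condition as \<open>dim V + 1 = n\<close> avoids truncated subtraction: for \<open>n = 0\<close> there are no
  hyperplanes.
\<close>

definition Gr_hyperplanes :: "nat \<Rightarrow> 'k::field vec set set" where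
  "Gr_hyperplanes n = {V. vsubspace n V \<and> vdim n V + 1 = n}"

definition weak_span_colouring ::
    "nat \<Rightarrow> 'v pair_pre_digraph \<Rightarrow> ('v \<Rightarrow> 'k::field vec) \<Rightarrow> bool" where
  "weak_span_colouring n G f \<longleftrightarrow>
     f \<in> pverts G \<rightarrow> carrier_vec n - {0\<^sub>v n} \<and>
     (\<forall>x\<in>pverts G. f x \<notin> vspan n (f ` neighbours G x))"

definition intermediate_span_colouring ::
    "nat \<Rightarrow> 'v pair_pre_digraph \<Rightarrow> ('v \<Rightarrow> 'k::field vec set) \<Rightarrow> bool" where
  "intermediate_span_colouring n G f \<longleftrightarrow>
     f \<in> pverts G \<rightarrow> proj_space n \<and>
     (\<forall>x\<in>pverts G. \<not> f x \<subseteq> vspan n (\<Union>y\<in>neighbours G x. f y))"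

definition span_colouring ::
    "nat \<Rightarrow> 'v pair_pre_digraph \<Rightarrow> ('v \<Rightarrow> 'k::field vec set \<times> 'k vec set) \<Rightarrow> bool" where
  "span_colouring n G f \<longleftrightarrow>
     f \<in> pverts G \<rightarrow> proj_space n \<times> Gr_hyperplanes n \<and>
     (\<forall>x\<in>pverts G. \<not> fst (f x) \<subseteq> snd (f x)) \<and>
     (\<forall>(x, y)\<in>parcs G. fst (f x) \<subseteq> snd (f y) \<and> fst (f y) \<subseteq> snd (f x))"

text \<open>
  In \<^typ>\<open>enat\<close> the infimum of a nonempty set is its least element, and the infimum of the empty
  set is \<open>\<infinity>\<close>.
\<close>

definition span_chromatic_number :: "'k::field itself \<Rightarrow> 'v pair_pre_digraph \<Rightarrow> enat" where
  "span_chromatic_number _ G =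
     (INF n\<in>{n. \<exists>f :: 'v \<Rightarrow> 'k vec set \<times> 'k vec set. span_colouring n G f}. enat n)"

definition intermediate_span_chromatic_number ::
    "'k::field itself \<Rightarrow> 'v pair_pre_digraph \<Rightarrow> enat" where
  "intermediate_span_chromatic_number _ G =
     (INF n\<in>{n. \<exists>f :: 'v \<Rightarrow> 'k vec set. intermediate_span_colouring n G f}. enat n)"

definition weak_span_chromatic_number :: "'k::field itself \<Rightarrow> 'v pair_pre_digraph \<Rightarrow> enat" where
  "weak_span_chromatic_number _ G =
     (INF n\<in>{n. \<exists>f :: 'v \<Rightarrow> 'k vec. weak_span_colouring n G f}. enat n)"

end

theory Submission
  imports Defs
begin

text \<open>
  Colourings of the three kinds can be converted into each other without changing \<open>n\<close>. From a
  span colouring keep the lines: the hyperplane at \<open>x\<close> contains the lines of all neighbours of \<open>x\<close>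
  but not the line of \<open>x\<close> itself. From an intermediate colouring keep one generator of each line.
  From a weak colouring \<open>f\<close> take the line spanned by \<open>f x\<close>, together with a hyperplane that contains
  the span of \<open>f\<close> on the neighbours of \<open>x\<close> and avoids \<open>f x\<close>.
\<close>

context vectorspace
begin

text \<open>Independent sets have at most \<open>dim\<close> elements, so a maximal one between
  \<open>A\<close> and \<open>N\<close> exists; a vector of \<open>N\<close> outside its span could
  still be adjoined, against maximality. With \<open>A\<close> empty this yields bases of subspaces,
  with \<open>N\<close> the whole carrier it completes \<open>A\<close> to a basis.\<close>

lemma lin_indpt_extend:
  assumes fd: "fin_dim" and N: "N \<subseteq> carrier V" and A: "A \<subseteq> N" "lin_indpt A"
  obtains C where "A \<subseteq> C" "C \<subseteq> N" "finite C" "lin_indpt C" "N \<subseteq> span C"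
proof -
  let ?P = "\<lambda>S. A \<subseteq> S \<and> S \<subseteq> N \<and> lin_indpt S"
  have "finite S \<and> card S \<le> dim" if "?P S" for S
    using li_le_dim[OF fd, of S] that N by auto
  then obtain C where C: "finite C" "maximal C ?P"
    using maximal_exists[of ?P dim A] A by blast
  then have PC: "?P C" and max: "\<And>B. C \<subseteq> B \<Longrightarrow> ?P B \<Longrightarrow> B = C"
    unfolding maximal_def by blast+
  have CV: "C \<subseteq> carrier V" using PC N by blast
  have "w \<in> span C" if w: "w \<in> N" for w
  proof (rule ccontr)
    assume w': "w \<notin> span C"
    then have "w \<notin> C" using in_own_span[OF CV] by blast
    then have "lin_indpt (C \<union> {w})"
      using lin_dep_iff_in_span[OF CV] w w' N PC by blast
    then have "C \<union> {w} = C" using PC w by (intro max) auto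
    then show False using \<open>w \<notin> C\<close> by blast
  qed
  then show thesis using that[of C] C(1) PC by blast
qed

lemma dim_span_lin_indpt:
  assumes A: "A \<subseteq> carrier V" "finite A" "lin_indpt A"
  shows "vectorspace.dim K (vs (span A)) = card A"
proof -
  have sub: "VectorSpace.subspace K (span A) V" by (rule span_is_subspace[OF A(1)])
  then have submod: "submodule K (span A) V" by simp
  interpret W: vectorspace K "vs (span A)" by (rule subspace_is_vs[OF sub])
  have AW: "A \<subseteq> span A" by (rule in_own_span[OF A(1)])
  \<comment> \<open>Independence and span were taken in \<open>V\<close>; for subsets of a submodule
    they agree with its own, so \<open>A\<close> is a basis of the subspace as a space in its own
    right.\<close>
  have "W.basis A"
    unfolding W.basis_def using span_li_not_depend[OF AW submod] A AW by simp
  then show ?thesis using W.dim_basis[OF A(2)] by simp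
qed

text \<open>A basis of a line has one element, and independence excludes zero. This turns a
  line-valued colouring into a vector-valued one.\<close>

lemma subspace_dim1_generator:
  assumes fd: "fin_dim" and U: "VectorSpace.subspace K U V" and dim1: "vectorspace.dim K (vs U) = 1"
  obtains u where "u \<in> carrier V" "u \<noteq> \<zero>\<^bsub>V\<^esub>" "U = span {u}"
proof -
  have sub: "submodule K U V" using U by simp
  then have UV: "U \<subseteq> carrier V" by (rule submodule.subset)
  have "lin_indpt {}" by (simp add: lin_dep_def)
  then obtain C where C: "C \<subseteq> U" "finite C" "lin_indpt C" "U \<subseteq> span C"
    using lin_indpt_extend[OF fd UV, of "{}"] by auto
  have eq: "U = span C" using C(4) span_is_subset[OF C(1) sub] by blast
  then have "card C = 1" using dim_span_lin_indpt[of C] C UV dim1 by auto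
  then obtain u where u: "C = {u}" by (auto simp: card_1_singleton_iff)
  have "u \<noteq> \<zero>\<^bsub>V\<^esub>" using vs_zero_lin_dep[of C] C UV u by auto
  then show thesis using that[of u] u eq C(1) UV by auto
qed

lemma dim_span_singleton:
  assumes "v \<in> carrier V" "v \<noteq> \<zero>\<^bsub>V\<^esub>"
  shows "vectorspace.dim K (vs (span {v})) = 1"
proof -
  have "lin_indpt {}" by (simp add: lin_dep_def)
  then have "lin_indpt {v}"
    using lin_dep_iff_in_span[of "{}" v] assms by (simp add: span_empty)
  then show ?thesis using dim_span_lin_indpt[of "{v}"] assms by simp
qed

text \<open>A basis \<open>A\<close> of \<open>W\<close> stays independent when \<open>v\<close> is
  added, because \<open>v\<close> is outside \<open>W\<close>. Completing to a basis
  \<open>C\<close> of the whole space and dropping \<open>v\<close> leaves a basis of the desired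
  hyperplane.\<close>

lemma separating_hyperplane:
  assumes fd: "fin_dim" and W: "VectorSpace.subspace K W V" and v: "v \<in> carrier V" "v \<notin> W"
  obtains H where "VectorSpace.subspace K H V" "vectorspace.dim K (vs H) + 1 = dim" "W \<subseteq> H" "v \<notin> H"
proof -
  have sub: "submodule K W V" using W by simp
  then have WV: "W \<subseteq> carrier V" by (rule submodule.subset)
  have "lin_indpt {}" by (simp add: lin_dep_def)
  then obtain A where A: "A \<subseteq> W" "finite A" "lin_indpt A" "W \<subseteq> span A"
    using lin_indpt_extend[OF fd WV, of "{}"] by auto
  have "v \<notin> span A" using span_is_subset[OF A(1) sub] v by blast
  then have "lin_indpt (A \<union> {v})"
    using lin_dep_iff_in_span[of A v] A WV v by blast
  then obtain C where C: "A \<union> {v} \<subseteq> C" "C \<subseteq> carrier V" "finite C" "lin_indpt C"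
      "carrier V \<subseteq> span C"
    using lin_indpt_extend[OF fd, of "carrier V" "A \<union> {v}"] A WV v by blast
  let ?B = "C - {v}"
  have B: "?B \<subseteq> carrier V" "finite ?B" "lin_indpt ?B" "?B \<union> {v} = C"
    using C subset_li_is_li[OF C(4), of ?B] by auto
  have "basis C" using C span_is_subset2[OF C(2)] by (auto simp: basis_def)
  then have "dim = card C" using dim_basis C(3) by blast
  moreover have "card ?B + 1 = card C" using C(1,3) card_Suc_Diff1[of C v] by simp
  ultimately have "vectorspace.dim K (vs (span ?B)) + 1 = dim"
    using dim_span_lin_indpt[OF B(1-3)] by simp
  \<comment> \<open>Otherwise \<open>C\<close>, which is \<open>?B\<close> with \<open>v\<close> put
    back, would be dependent.\<close>
  moreover have "v \<notin> span ?B"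
    using lin_dep_iff_in_span[OF B(1,3) v(1)] B(4) C(4) by simp
  moreover have "W \<subseteq> span ?B"
  proof -
    \<comment> \<open>Since \<open>v\<close> lies outside \<open>W\<close>, dropping it takes
      nothing from \<open>A\<close>.\<close>
    have "A \<subseteq> ?B" using A(1) C(1) v(2) by blast
    then show ?thesis using A(4) span_is_monotone by blast
  qed
  ultimately show thesis using that span_is_subspace[OF B(1)] by blast
qed

end

lemma span_imp_intermediate:
  fixes f :: "'v \<Rightarrow> 'k::field vec set \<times> 'k vec set"
  assumes "pair_bidirected_digraph G" and f: "span_colouring n G f"
  shows "intermediate_span_colouring n G (fst \<circ> f)"
proof -
  interpret pair_bidirected_digraph G by fact
  interpret vec_space "TYPE('k)" n .
  have "\<not> fst (f x) \<subseteq> vspan n (\<Union>y\<in>neighbours G x. fst (f y))" if x: "x \<in> pverts G" for x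
  proof -
    have "f x \<in> proj_space n \<times> Gr_hyperplanes n"
      using f x by (auto simp: span_colouring_def)
    then have "submodule class_ring (snd (f x)) V"
      by (auto simp: Gr_hyperplanes_def)
    \<comment> \<open>For an arc from \<open>x\<close> to \<open>y\<close>, the second half of the
      edge condition puts the line of \<open>y\<close> into the hyperplane of
      \<open>x\<close>.\<close>
    moreover have "(\<Union>y\<in>neighbours G x. fst (f y)) \<subseteq> snd (f x)"
      using f unfolding span_colouring_def neighbours_def by blast
    ultimately have "vspan n (\<Union>y\<in>neighbours G x. fst (f y)) \<subseteq> snd (f x)"
      by (intro span_is_subset)
    then show ?thesis using f x unfolding span_colouring_def by blast
  qed
  then show ?thesis
    using f by (auto simp: intermediate_span_colouring_def span_colouring_def Pi_iff mem_Times_iff)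
qed

lemma intermediate_imp_weak:
  fixes f :: "'v \<Rightarrow> 'k::field vec set"
  assumes "pair_bidirected_digraph G" and f: "intermediate_span_colouring n G f"
  shows "\<exists>g :: 'v \<Rightarrow> 'k vec. weak_span_colouring n G g"
proof -
  interpret pair_bidirected_digraph G by fact
  interpret vec_space "TYPE('k)" n .
  have "\<exists>u. u \<in> carrier_vec n \<and> u \<noteq> 0\<^sub>v n \<and> f x = vspan n {u}" if "x \<in> pverts G" for x
  proof -
    have "vsubspace n (f x)" "vdim n (f x) = 1"
      using f that by (auto simp: intermediate_span_colouring_def proj_space_def)
    then obtain u where "u \<in> carrier_vec n" "u \<noteq> 0\<^sub>v n" "f x = vspan n {u}"
      by (rule subspace_dim1_generator[OF fin_dim])
    then show ?thesis by blast
  qed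
  then obtain g where g: "\<And>x. x \<in> pverts G \<Longrightarrow>
      g x \<in> carrier_vec n \<and> g x \<noteq> 0\<^sub>v n \<and> f x = vspan n {g x}"
    by metis
  \<comment> \<open>A generator in the span of the neighbouring generators would lie in the span of
    their lines, and its whole line with it, contrary to the choice of \<open>f\<close>.\<close>
  have "g x \<notin> vspan n (g ` neighbours G x)" if x: "x \<in> pverts G" for x
  proof
    assume mem: "g x \<in> vspan n (g ` neighbours G x)"
    have nb: "neighbours G x \<subseteq> pverts G"
      by (auto simp: neighbours_def dest: wellformed')
    have "g y \<in> f y" if "y \<in> neighbours G x" for y
      using g[of y] nb that in_own_span[of "{g y}"] by auto
    then have "vspan n (g ` neighbours G x) \<subseteq> vspan n (\<Union>y\<in>neighbours G x. f y)"
      by (intro span_is_monotone) blast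
    moreover have "f y \<subseteq> carrier_vec n" if "y \<in> neighbours G x" for y
      using g[of y] nb that span_is_subset2[of "{g y}"] by auto
    then have "(\<Union>y\<in>neighbours G x. f y) \<subseteq> carrier_vec n" by blast
    then have "submodule class_ring (vspan n (\<Union>y\<in>neighbours G x. f y)) V"
      by (rule span_is_submodule)
    ultimately have "vspan n {g x} \<subseteq> vspan n (\<Union>y\<in>neighbours G x. f y)"
      using mem by (intro span_is_subset) blast+
    then have "f x \<subseteq> vspan n (\<Union>y\<in>neighbours G x. f y)" using g[OF x] by simp
    then show False using f x by (auto simp: intermediate_span_colouring_def)
  qed
  then have "weak_span_colouring n G g" using g by (auto simp: weak_span_colouring_def)
  then show ?thesis by blast
qed

lemma weak_imp_span:
  fixes f :: "'v \<Rightarrow> 'k::field vec"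
  assumes "pair_bidirected_digraph G" and f: "weak_span_colouring n G f"
  shows "\<exists>g :: 'v \<Rightarrow> 'k vec set \<times> 'k vec set. span_colouring n G g"
proof -
  interpret pair_bidirected_digraph G by fact
  interpret vec_space "TYPE('k)" n .
  have fC: "f x \<in> carrier_vec n" "f x \<noteq> 0\<^sub>v n" if "x \<in> pverts G" for x
    using f that by (auto simp: weak_span_colouring_def)
  have nbC: "f ` neighbours G x \<subseteq> carrier_vec n" for x
    using fC by (auto simp: neighbours_def dest: wellformed')
  have "\<exists>H. H \<in> Gr_hyperplanes n \<and> vspan n (f ` neighbours G x) \<subseteq> H \<and> f x \<notin> H"
    if x: "x \<in> pverts G" for x
  proof -
    have "vsubspace n (vspan n (f ` neighbours G x))" using nbC span_is_subspace by simp
    moreover have "f x \<notin> vspan n (f ` neighbours G x)"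
      using f x by (auto simp: weak_span_colouring_def)
    ultimately obtain H where "vsubspace n H" "vdim n H + 1 = dim"
        "vspan n (f ` neighbours G x) \<subseteq> H" "f x \<notin> H"
      using separating_hyperplane[OF fin_dim _ fC(1)[OF x]] by blast
    then show ?thesis by (auto simp: Gr_hyperplanes_def dim_is_n)
  qed
  then obtain H where H: "\<And>x. x \<in> pverts G \<Longrightarrow>
      H x \<in> Gr_hyperplanes n \<and> vspan n (f ` neighbours G x) \<subseteq> H x \<and> f x \<notin> H x"
    by metis
  have line: "vspan n {f x} \<in> proj_space n" if "x \<in> pverts G" for x
    using fC[OF that] span_is_subspace[of "{f x}"] dim_span_singleton[of "f x"]
    by (simp add: proj_space_def)
  have mem: "f x \<in> vspan n {f x}" if "x \<in> pverts G" for x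
    using fC[OF that] in_own_span[of "{f x}"] by auto
  have edge: "vspan n {f x} \<subseteq> H y" if xy: "(x, y) \<in> parcs G" for x y
  proof -
    \<comment> \<open>\<open>neighbours G y\<close> is read off the arcs leaving \<open>y\<close>,
      so the given arc has to be reversed.\<close>
    have "x \<in> neighbours G y"
      using xy pair_sym_arcs by (auto simp: neighbours_def symmetric_def sym_def)
    then have "f x \<in> H y"
      using in_own_span[of "f ` neighbours G y"] nbC[of y] H[of y] wellformed'(2)[OF xy] by auto
    moreover have "submodule class_ring (H y) V"
      using H[of y] wellformed'(2)[OF xy] by (auto simp: Gr_hyperplanes_def)
    ultimately show ?thesis by (intro span_is_subset) auto
  qed
  have sym: "(y, x) \<in> parcs G" if "(x, y) \<in> parcs G" for x y
    using that pair_sym_arcs by (auto simp: symmetric_def sym_def)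
  have "span_colouring n G (\<lambda>x. (vspan n {f x}, H x))"
    unfolding span_colouring_def
  proof (intro conjI ballI)
    show "(\<lambda>x. (vspan n {f x}, H x)) \<in> pverts G \<rightarrow> proj_space n \<times> Gr_hyperplanes n"
      using H line by blast
    show "\<not> fst (vspan n {f x}, H x) \<subseteq> snd (vspan n {f x}, H x)" if "x \<in> pverts G" for x
      using H[OF that] mem[OF that] unfolding fst_conv snd_conv by blast
    show "case e of (x, y) \<Rightarrow> fst (vspan n {f x}, H x) \<subseteq> snd (vspan n {f y}, H y)
        \<and> fst (vspan n {f y}, H y) \<subseteq> snd (vspan n {f x}, H x)" if "e \<in> parcs G" for e
    proof (cases e)
      case (Pair x y)
      \<comment> \<open>The two halves of the condition are \<open>edge\<close> for the arc and for
        its reverse.\<close>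
      then show ?thesis using edge[of x y] edge[OF sym[of x y]] that by simp
    qed
  qed
  then show ?thesis by blast
qed

theorem proposition3p8:
  fixes G :: "'v pair_pre_digraph"
  assumes "pair_bidirected_digraph G"
  shows "span_chromatic_number TYPE('k::field) G = intermediate_span_chromatic_number TYPE('k) G
       \<and> intermediate_span_chromatic_number TYPE('k) G = weak_span_chromatic_number TYPE('k) G"
proof -
  have "(\<exists>f :: 'v \<Rightarrow> 'k vec set \<times> 'k vec set. span_colouring n G f)
      \<longleftrightarrow> (\<exists>f :: 'v \<Rightarrow> 'k vec set. intermediate_span_colouring n G f)"
    and "(\<exists>f :: 'v \<Rightarrow> 'k vec set. intermediate_span_colouring n G f)
      \<longleftrightarrow> (\<exists>f :: 'v \<Rightarrow> 'k vec. weak_span_colouring n G f)" for n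
    \<comment> \<open>The three implications close a cycle for each \<open>n\<close>, so the three
      infima range over the same set, also when it is empty.\<close>
    using span_imp_intermediate[OF assms] intermediate_imp_weak[OF assms] weak_imp_span[OF assms]
    by blast+
  then show ?thesis
    unfolding span_chromatic_number_def intermediate_span_chromatic_number_def
      weak_span_chromatic_number_def by simp
qed

end
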